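(* Let $G=(N,\Sigma,P,S)$ be a context-free grammar in Chomsky normal form and consider the left-corner push-down automaton for $G$. Given a parse $T$ of $G$ (rooted at $S$), the degree of center-embedding of $T$ is equal to the maximum value of the stack depth after a reduce transition, minus one, for recognizing $T$ on the left-corner push-down automaton. (The maximum is over all reduce transitions in the transition sequence recognizing $T$, of the stack depth of the configuration immediately after that transition.)
   Context: **Grammar.** A CFG is $G=(N,\Sigma,P,S)$ (nonterminals, terminals, rules, start symbol). It is in Chomsky normal form (CNF) if every rule is $A\to B\,C$ or $A\to a$ with $A,B,C\in N$, $a\in\Sigma$. $\Rightarrow_{lm}$ is the left-most derivation relation, $\Rightarrow_{lm}^+$ / $\Rightarrow_{lm}^*$ mean one or more / zero or more steps. $A,B,C,\dots$ are nonterminals, $v,w,x,\dots\in\Sigma^*$, $\alpha,\beta,\dots\in(N\cup\Sigma)^*$. **Left-corner PDA.** Stack symbols are nonterminals $A$ (called complete) and pairs $A/B$ with $A,B\in N$ (called incomplete). Stacks are written with the top on the right. A configuration is a pair (stack, number of input tokens read). For a sentence of length $n$ the initial configuration is (empty stack, $0$) and the final configuration is (stack consisting of the single symbol $S$, $n$). The transitions act on the top of the stack: - SHIFT: reads the next input token $a$ and pushes $A$, if $A\to a\in P$ (applicable to any stack, including the empty one). - SCAN: reads the next input token $a$ and replaces the top symbol $A/B$ by $A$, if $B\to a\in P$. - PREDICTION: reads nothing and replaces the top symbol $A$ by $B/C$, if $B\to A\,C\in P$. - COMPOSITION: reads nothing and replaces the two top symbols $A/B\;\,C$ by $A/D$,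 if $B\to C\,D\in P$. SHIFT and SCAN are shift transitions; PREDICTION and COMPOSITION are reduce transitions. The stack depth of a configuration is the number of symbols on its stack. **Recognizing a parse.** A stack symbol $A$ stands for a finished parse subtree rooted at $A$; $A/B$ stands for a partial subtree rooted at $A$ whose right-most leaf is an unexpanded node $B$ (all other leaves being terminals). SHIFT creates the tree $A\to a$; SCAN expands the open leaf $B$ by $B\to a$; PREDICTION puts the tree rooted at $A$ as the left child of a new root $B$ with open right child $C$; COMPOSITION expands the open leaf $B$ by $B\to C\,D$, with left child the finished tree rooted at $C$ and open right child $D$. The transition sequence recognizing a parse $T$ is the sequence of transitions from the initial to the final configuration such that the tree represented by the symbol $S$ in the final configuration is $T$. **Degree of center-embedding of a parse.** The degree of a parse $T$ is the maximum $m$ of all values $m'$ for which the following derivation is found in $T$ (and $0$ if there is none with $m'\ge 1$): $$S \Rightarrow_{lm}^* v \underline{A} \alpha \Rightarrow_{lm}^+ v w_1 \underline{B_1} \alpha \Rightarrow_{lm}^+ v w_1 \underline{C_1} \beta_1 \alpha \Rightarrow_{lm}^+ v w_1 w_2 \underline{B_2} \beta_1 \alpha \Rightarrow_{lm}^+ v w_1 w_2 \underline{C_2} \beta_2 \beta_1 \alpha \Rightarrow_{lm}^+\cdots$$ $$\Rightarrow_{lm}^+ v w_1 \cdots w_{m'} \underline{B_{m'}} \beta_{m'-1} \cdots \beta_1 \alpha \Rightarrow_{lm}^+ v w_1 \cdots w_{m'} \underline{C_{m'}} \beta_{m'} \cdots \beta_1 \alpha \Rightarrow_{lm}^+ v w_1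 \cdots w_{m'}\, x\, \beta_{m'} \cdots \beta_1 \alpha,\qquad |x|\ge 2 .$$ An underlined symbol is a node of $T$ that is expanded in the following steps. Thus $B_1$ is reached from the node $A$ by one or more right-child edges, each $C_i$ is reached from $B_i$ by one or more left-child edges, each $B_{i+1}$ is reached from $C_i$ by one or more right-child edges, and $C_{m'}$ spans at least two words. *)

theory Defs
  imports Main
begin

datatype ('n, 't) symbol = NT 'n | Tm 't

record ('n, 't) cfg =
  nonterminals :: "'n set"
  terminals :: "'t set"
  rules :: "('n \<times> ('n, 't) symbol list) set"
  start :: 'n

definition cfg :: "('n, 't) cfg \<Rightarrow> bool" where
  "cfg G \<longleftrightarrow>
     finite (nonterminals G) \<and> finite (terminals G) \<and> finite (rules G) \<and>
     start G \<in> nonterminals G \<and>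
     rules G \<subseteq> nonterminals G \<times> lists (NT ` nonterminals G \<union> Tm ` terminals G)"

definition cnf :: "('n, 't) cfg \<Rightarrow> bool" where
  "cnf G \<longleftrightarrow>
     (\<forall>(A, \<gamma>) \<in> rules G.
        (\<exists>B \<in> nonterminals G. \<exists>C \<in> nonterminals G. \<gamma> = [NT B, NT C]) \<or>
        (\<exists>a \<in> terminals G. \<gamma> = [Tm a]))"

inductive lm_step :: "('n, 't) cfg \<Rightarrow> ('n, 't) symbol list \<Rightarrow> ('n, 't) symbol list \<Rightarrow> bool"
  for G :: "('n, 't) cfg" where
  "(A, \<gamma>) \<in> rules G \<Longrightarrow> lm_step G (map Tm v @ NT A # \<alpha>) (map Tm v @ \<gamma> @ \<alpha>)"


section \<open>Parses\<close>

text \<open>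
  Trees for grammars in Chomsky normal form: \<open>Lex A a\<close> is the tree of \<open>A \<rightarrow> a\<close>, \<open>Bin A l r\<close> the
  tree with root \<open>A\<close> and children \<open>l\<close>, \<open>r\<close>. The unexpanded node \<open>Open B\<close> occurs only in the
  partial trees that the automaton builds, not in parses.
\<close>

datatype ('n, 't) tree = Open 'n | Lex 'n 't | Bin 'n "('n, 't) tree" "('n, 't) tree"

fun root :: "('n, 't) tree \<Rightarrow> 'n" where
  "root (Open A) = A"
| "root (Lex A a) = A"
| "root (Bin A l r) = A"

fun yield :: "('n, 't) tree \<Rightarrow> 't list" where
  "yield (Open A) = []"
| "yield (Lex A a) = [a]"
| "yield (Bin A l r) = yield l @ yield r"

fun parse_subtree :: "('n, 't) cfg \<Rightarrow> ('n, 't) tree \<Rightarrow> bool" where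
  "parse_subtree G (Open A) \<longleftrightarrow> False"
| "parse_subtree G (Lex A a) \<longleftrightarrow> (A, [Tm a]) \<in> rules G"
| "parse_subtree G (Bin A l r) \<longleftrightarrow>
     (A, [NT (root l), NT (root r)]) \<in> rules G \<and> parse_subtree G l \<and> parse_subtree G r"

definition parse :: "('n, 't) cfg \<Rightarrow> ('n, 't) tree \<Rightarrow> bool" where
  "parse G T \<longleftrightarrow> parse_subtree G T \<and> root T = start G"


section \<open>Degree of center-embedding\<close>

text \<open>
  The nonterminals of a derivation found in a parse \<open>T\<close> are nodes of \<open>T\<close>, so that different
  occurrences of one nonterminal of the grammar have to be distinguished. A node is therefore
  represented by its address (the path from the root), and the left-most derivations found in \<open>T\<close>
  are those of the grammar whose nonterminals are the nodes of \<open>T\<close> and whose only rule for a node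
  is its expansion in \<open>T\<close>. The lemma \<open>node_derivation\<close> below shows that replacing every node by
  its label gives a left-most derivation of the original grammar.
\<close>

datatype direction = L | R

type_synonym node = "direction list"

fun node_rules :: "node \<Rightarrow> ('n, 't) tree \<Rightarrow> (node \<times> (node, 't) symbol list) set" where
  "node_rules p (Open A) = {}"
| "node_rules p (Lex A a) = {(p, [Tm a])}"
| "node_rules p (Bin A l r) =
     insert (p, [NT (p @ [L]), NT (p @ [R])]) (node_rules (p @ [L]) l \<union> node_rules (p @ [R]) r)"

definition node_grammar :: "('n, 't) tree \<Rightarrow> (node, 't) cfg" where
  "node_grammar T =
     \<lparr>nonterminals = fst ` node_rules [] T, terminals = set (yield T),
      rules = node_rules [] T, start = []\<rparr>"

fun label :: "('n, 't) tree \<Rightarrow> node \<Rightarrow> 'n" where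
  "label T [] = root T"
| "label (Bin A l r) (L # p) = label l p"
| "label (Bin A l r) (R # p) = label r p"
| "label T p = root T"

definition label_symbol :: "('n, 't) tree \<Rightarrow> (node, 't) symbol \<Rightarrow> ('n, 't) symbol" where
  "label_symbol T X = (case X of NT p \<Rightarrow> NT (label T p) | Tm a \<Rightarrow> Tm a)"

lemma node_rules_labels:
  assumes "parse_subtree G U" and "\<And>p. label T (q @ p) = label U p"
    and "(p, \<gamma>) \<in> node_rules q U"
  shows "(label T p, map (label_symbol T) \<gamma>) \<in> rules G"
  using assms
proof (induction U arbitrary: q)
  case (Open A)
  then show ?case by simp
next
  case (Lex A a)
  then show ?case using Lex.prems(2)[of "[]"] by (simp add: label_symbol_def)
next
  case (Bin A l r)
  have l: "label T ((q @ [L]) @ p) = label l p" and r: "label T ((q @ [R]) @ p) = label r p" for p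
    using Bin.prems(2)[of "L # p"] Bin.prems(2)[of "R # p"] by auto
  consider "p = q" "\<gamma> = [NT (q @ [L]), NT (q @ [R])]"
    | "(p, \<gamma>) \<in> node_rules (q @ [L]) l" | "(p, \<gamma>) \<in> node_rules (q @ [R]) r"
    using Bin.prems(3) by auto
  then show ?case
  proof cases
    case 1
    then show ?thesis
      using Bin.prems(1) Bin.prems(2)[of "[]"] l[of "[]"] r[of "[]"] by (simp add: label_symbol_def)
  next
    case 2
    then show ?thesis using Bin.IH(1)[OF _ l] Bin.prems(1) by simp
  next
    case 3
    then show ?thesis using Bin.IH(2)[OF _ r] Bin.prems(1) by simp
  qed
qed

lemma node_derivation:
  assumes "parse G T" and "lm_step (node_grammar T) \<alpha> \<beta>"
  shows "lm_step G (map (label_symbol T) \<alpha>) (map (label_symbol T) \<beta>)"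
  using assms(2)
proof cases
  case (1 A \<gamma> v \<delta>)
  have "(label T A, map (label_symbol T) \<gamma>) \<in> rules G"
    using assms(1) 1(3) node_rules_labels[of G T T "[]" A \<gamma>]
    by (simp add: parse_def node_grammar_def)
  then show ?thesis
    using lm_step.intros[of "label T A" "map (label_symbol T) \<gamma>" G v "map (label_symbol T) \<delta>"]
    by (simp add: 1(1,2) label_symbol_def comp_def)
qed

text \<open>
  In the following, \<open>pre i\<close> is \<open>v w\<^sub>1 \<dots> w\<^sub>i\<close> and \<open>suf i\<close> is \<open>\<beta>\<^sub>i \<dots> \<beta>\<^sub>1 \<alpha>\<close>.
\<close>

definition center_embedding :: "('n, 't) tree \<Rightarrow> nat \<Rightarrow> bool" where
  "center_embedding T m \<longleftrightarrow>
     m \<ge> 1 \<and>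
     (\<exists>v A \<alpha> w B C \<beta> x.
        let step = lm_step (node_grammar T);
            pre = (\<lambda>i. map Tm (v @ concat (map w [1..<Suc i])));
            suf = (\<lambda>i. concat (map \<beta> (rev [1..<Suc i])) @ \<alpha>)
        in step\<^sup>*\<^sup>* [NT (start (node_grammar T))] (map Tm v @ NT A # \<alpha>) \<and>
           step\<^sup>+\<^sup>+ (map Tm v @ NT A # \<alpha>) (pre 1 @ NT (B 1) # \<alpha>) \<and>
           (\<forall>i \<in> {1..m}. step\<^sup>+\<^sup>+ (pre i @ NT (B i) # suf (i - 1)) (pre i @ NT (C i) # suf i)) \<and>
           (\<forall>i \<in> {1..<m}. step\<^sup>+\<^sup>+ (pre i @ NT (C i) # suf i) (pre (i + 1) @ NT (B (i + 1)) # suf i)) \<and>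
           step\<^sup>+\<^sup>+ (pre m @ NT (C m) # suf m) (pre m @ map Tm x @ suf m) \<and>
           length x \<ge> 2)"

definition degree :: "('n, 't) tree \<Rightarrow> nat" where
  "degree T = Max (insert 0 {m. center_embedding T m})"


section \<open>The left-corner push-down automaton\<close>

datatype 'n stack_symbol = Complete 'n | Incomplete 'n 'n

text \<open>
  Stacks are lists with the top at the head. Each transition carries the rule that it applies:
  \<open>Shift A a\<close> and \<open>Scan A a\<close> apply \<open>A \<rightarrow> a\<close>, \<open>Prediction A B C\<close> and \<open>Composition A B C\<close> apply
  \<open>A \<rightarrow> B C\<close>.
\<close>

type_synonym 'n config = "'n stack_symbol list \<times> nat"

datatype ('n, 't) transition =
  Shift 'n 't | Scan 'n 't | Prediction 'n 'n 'n | Composition 'n 'n 'n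

inductive lc_step ::
  "('n, 't) cfg \<Rightarrow> 't list \<Rightarrow> ('n, 't) transition \<Rightarrow> 'n config \<Rightarrow> 'n config \<Rightarrow> bool"
  for G :: "('n, 't) cfg" and w :: "'t list" where
  shift: "\<lbrakk>i < length w; w ! i = a; (A, [Tm a]) \<in> rules G\<rbrakk> \<Longrightarrow>
    lc_step G w (Shift A a) (\<sigma>, i) (Complete A # \<sigma>, i + 1)"
| scan: "\<lbrakk>i < length w; w ! i = a; (B, [Tm a]) \<in> rules G\<rbrakk> \<Longrightarrow>
    lc_step G w (Scan B a) (Incomplete A B # \<sigma>, i) (Complete A # \<sigma>, i + 1)"
| prediction: "(B, [NT A, NT C]) \<in> rules G \<Longrightarrow>
    lc_step G w (Prediction B A C) (Complete A # \<sigma>, i) (Incomplete B C # \<sigma>, i)"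
| composition: "(B, [NT C, NT D]) \<in> rules G \<Longrightarrow>
    lc_step G w (Composition B C D) (Complete C # Incomplete A B # \<sigma>, i) (Incomplete A D # \<sigma>, i)"

fun is_reduce :: "('n, 't) transition \<Rightarrow> bool" where
  "is_reduce (Prediction _ _ _) = True"
| "is_reduce (Composition _ _ _) = True"
| "is_reduce _ = False"

text \<open>
  A transition sequence lists every transition together with the configuration reached by it.
\<close>

fun lc_run ::
  "('n, 't) cfg \<Rightarrow> 't list \<Rightarrow> 'n config \<Rightarrow> (('n, 't) transition \<times> 'n config) list \<Rightarrow> 'n config \<Rightarrow> bool"
where
  "lc_run G w c [] c' \<longleftrightarrow> c = c'"
| "lc_run G w c ((t, d) # \<rho>) c' \<longleftrightarrow> lc_step G w t c d \<and> lc_run G w d \<rho> c'"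

fun expand_open :: "('n, 't) tree \<Rightarrow> ('n, 't) tree \<Rightarrow> ('n, 't) tree" where
  "expand_open (Open B) s = s"
| "expand_open (Lex A a) s = Lex A a"
| "expand_open (Bin A l r) s = Bin A l (expand_open r s)"

text \<open>
  The effect of a transition on the trees that the stack symbols stand for. The last equation
  concerns only stacks on which the transition is not applicable.
\<close>

fun build :: "('n, 't) transition \<Rightarrow> ('n, 't) tree list \<Rightarrow> ('n, 't) tree list" where
  "build (Shift A a) \<tau> = Lex A a # \<tau>"
| "build (Scan B a) (t # \<tau>) = expand_open t (Lex B a) # \<tau>"
| "build (Prediction B A C) (t # \<tau>) = Bin B t (Open C) # \<tau>"
| "build (Composition B C D) (t # u # \<tau>) = expand_open u (Bin B t (Open D)) # \<tau>"
| "build _ \<tau> = \<tau>"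

definition recognizes ::
  "('n, 't) cfg \<Rightarrow> ('n, 't) tree \<Rightarrow> (('n, 't) transition \<times> 'n config) list \<Rightarrow> bool" where
  "recognizes G T \<rho> \<longleftrightarrow>
     lc_run G (yield T) ([], 0) \<rho> ([Complete (start G)], length (yield T)) \<and>
     fold build (map fst \<rho>) [] = [T]"

definition reduce_depths :: "(('n, 't) transition \<times> 'n config) list \<Rightarrow> nat set" where
  "reduce_depths \<rho> = {length \<sigma> | t \<sigma> i. (t, (\<sigma>, i)) \<in> set \<rho> \<and> is_reduce t}"

end

theory Submission
  imports Defs
begin

text \<open>
  The automaton recognizes the left child of a node on top of the stack, whereas the right child is
  absorbed by the incomplete symbol of its parent. Hence a symbol is added exactly where the path
  from the root leaves a right spine through a left child with at least two words, and the stack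
  depth counts the alternations of right and left edges that define the degree. The
  transition sequence is unique because the tree on top of the stack determines the transition
  that created it.
\<close>

section \<open>The stack depth as a function of the parse\<close>

text \<open>The subtracted one comes from the symbol that a reduce transition itself leaves on the
  stack: a parse with two words has \<open>ldepth\<close> 1 but no embedding. A left child with a
  single word is shifted and consumed at once, with no reduce transition at the raised depth in
  between; this matches the condition |x| >= 2. Two functions are needed because a left edge has two
  costs. Below a left corner it is free, as \<open>ldepth l\<close> enters unchanged; a right edge
  switches to \<open>rdepth\<close>, where the next left edge costs one. In the degree, likewise,
  left edges are free at the start (the node A is arbitrary) and while a segment from B to C is
  being prolonged; only a right edge followed by a left edge opens a level. The obstacle is that the
  degree speaks of sentential forms and not of edges. The edges have to be recovered from what a
  derivation leaves unchanged: an unchanged suffix forces right edges, an unchanged terminal prefix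
  forces left edges.\<close>

text \<open>
  \<open>ldepth\<close> is the maximal number of symbols that the reduce transitions leave on top of the given
  stack while a tree is recognized from its left corner, \<open>rdepth\<close> the same for a tree that
  replaces the open leaf of the topmost symbol, that symbol included.
\<close>

fun ldepth :: "('n, 't) tree \<Rightarrow> nat" and rdepth :: "('n, 't) tree \<Rightarrow> nat" where
  "ldepth (Open A) = 0"
| "ldepth (Lex A a) = 0"
| "ldepth (Bin A l r) = max (max 1 (ldepth l)) (rdepth r)"
| "rdepth (Open A) = 0"
| "rdepth (Lex A a) = 0"
| "rdepth (Bin A l r) = max (Suc (ldepth l)) (rdepth r)"

lemma ldepth_le_rdepth: "ldepth t \<le> rdepth t"
  by (cases t) auto


section \<open>The transition sequence of a parse\<close>

text \<open>In \<open>rmoves\<close>, \<open>X\<close> is the root of the partial tree whose open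
  leaf is being filled, and \<open>\<sigma>\<close> is the stack below the symbol of that
  tree.\<close>

fun lmoves :: "('n, 't) tree \<Rightarrow> 'n stack_symbol list \<Rightarrow> nat \<Rightarrow> (('n, 't) transition \<times> 'n config) list"
  and rmoves ::
    "('n, 't) tree \<Rightarrow> 'n \<Rightarrow> 'n stack_symbol list \<Rightarrow> nat \<Rightarrow> (('n, 't) transition \<times> 'n config) list"
where
  "lmoves (Open A) \<sigma> i = []"
| "lmoves (Lex A a) \<sigma> i = [(Shift A a, (Complete A # \<sigma>, i + 1))]"
| "lmoves (Bin A l r) \<sigma> i =
     lmoves l \<sigma> i @
     (Prediction A (root l) (root r), (Incomplete A (root r) # \<sigma>, i + length (yield l))) #
     rmoves r A \<sigma> (i + length (yield l))"
| "rmoves (Open A) X \<sigma> i = []"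
| "rmoves (Lex A a) X \<sigma> i = [(Scan A a, (Complete X # \<sigma>, i + 1))]"
| "rmoves (Bin A l r) X \<sigma> i =
     lmoves l (Incomplete X A # \<sigma>) i @
     (Composition A (root l) (root r), (Incomplete X (root r) # \<sigma>, i + length (yield l))) #
     rmoves r X \<sigma> (i + length (yield l))"

lemma lc_run_append:
  "lc_run G w c (\<rho> @ \<rho>') c'' \<longleftrightarrow> (\<exists>c'. lc_run G w c \<rho> c' \<and> lc_run G w c' \<rho>' c'')"
  by (induction \<rho> arbitrary: c) (auto simp del: split_paired_Ex)

text \<open>Simplification turns \<open>i + 1\<close> into \<open>Suc i\<close>; the rules are
  restated so that they still match.\<close>

lemmas lc_step_Suc = lc_step.intros[unfolded Suc_eq_plus1[symmetric]]

text \<open>The input is split around \<open>yield t\<close> so that the induction can move words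
  between the contexts: \<open>yield r\<close> joins the right context for the left child,
  \<open>yield l\<close> the left context for the right child.\<close>

lemma lc_run_moves:
  assumes "parse_subtree G t"
  shows "lc_run G (u @ yield t @ v) (\<sigma>, length u) (lmoves t \<sigma> (length u))
      (Complete (root t) # \<sigma>, length u + length (yield t))"
    and "lc_run G (u @ yield t @ v) (Incomplete X (root t) # \<sigma>, length u) (rmoves t X \<sigma> (length u))
      (Complete X # \<sigma>, length u + length (yield t))"
  using assms
proof (induction t arbitrary: u v \<sigma> X)
  case (Open A)
  { case 1 then show ?case by simp }
  { case 2 then show ?case by simp }
next
  case (Lex A a)
  { case 1 then show ?case by (auto intro!: lc_step_Suc) }
  { case 2 then show ?case by (auto intro!: lc_step_Suc) }
next
  case (Bin A l r)
  { case 1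
    then show ?case
      using Bin.IH(1)[of u "yield r @ v" \<sigma>] Bin.IH(4)[of "u @ yield l" v A \<sigma>]
      by (auto simp: lc_run_append intro!: exI lc_step_Suc) (simp add: add.assoc) }
  { case 2
    then show ?case
      using Bin.IH(1)[of u "yield r @ v" "Incomplete X A # \<sigma>"]
        Bin.IH(4)[of "u @ yield l" v X \<sigma>]
      by (auto simp: lc_run_append intro!: exI lc_step_Suc) (simp add: add.assoc) }
qed

lemma expand_open_expand_open:
  "expand_open (expand_open t s) s' = expand_open t (expand_open s s')"
  by (induction t) auto

text \<open>COMPOSITION fills an open leaf with a node that is itself open on the right. Filling in
  these two stages agrees with inserting the finished subtree, by associativity of
  \<open>expand_open\<close>.\<close>

lemma build_moves:
  assumes "parse_subtree G t"
  shows "fold build (map fst (lmoves t \<sigma> i)) \<tau> = t # \<tau>"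
    and "fold build (map fst (rmoves t X \<sigma> i)) (u # \<tau>) = expand_open u t # \<tau>"
  using assms by (induction t arbitrary: \<tau> \<sigma> i X u) (auto simp: expand_open_expand_open)

lemma recognizes_lmoves: "parse G T \<Longrightarrow> recognizes G T (lmoves T [] 0)"
  using lc_run_moves(1)[of G T "[]" "[]" "[]"] build_moves(1)[of G T "[]" 0 "[]"]
  by (simp add: recognizes_def parse_def)

lemma reduce_depths_simps [simp]:
  "reduce_depths [] = {}"
  "reduce_depths (\<rho> @ \<rho>') = reduce_depths \<rho> \<union> reduce_depths \<rho>'"
  "reduce_depths ((x, (\<sigma>, i)) # \<rho>) = (if is_reduce x then {length \<sigma>} else {}) \<union> reduce_depths \<rho>"
  unfolding reduce_depths_def by (simp, simp, blast) (auto; blast)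

lemma reduce_depths_moves_le:
  "d \<in> reduce_depths (lmoves t \<sigma> i) \<Longrightarrow> d \<le> length \<sigma> + ldepth t"
  "d \<in> reduce_depths (rmoves t X \<sigma> i) \<Longrightarrow> d \<le> length \<sigma> + rdepth t"
  by (induction t arbitrary: \<sigma> i X) (fastforce simp: max_def)+

lemma depth_in_reduce_depths_moves:
  "ldepth t > 0 \<Longrightarrow> length \<sigma> + ldepth t \<in> reduce_depths (lmoves t \<sigma> i)"
  "rdepth t > 0 \<Longrightarrow> length \<sigma> + rdepth t \<in> reduce_depths (rmoves t X \<sigma> i)"
proof (induction t arbitrary: \<sigma> i X)
  case (Bin A l r)
  { case 1
    \<comment> \<open>The value 1 is attained by the PREDICTION of the node itself; any larger value
      is inherited from a child.\<close>
    have "ldepth (Bin A l r) = 1 \<or> ldepth (Bin A l r) = ldepth l \<and> ldepth l > 0 \<or>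
      ldepth (Bin A l r) = rdepth r \<and> rdepth r > 0"
      by (auto simp: max_def)
    then show ?case using Bin.IH(1)[of \<sigma> i] Bin.IH(4)[of \<sigma> A] by (elim disjE conjE) auto }
  { case 2
    have "rdepth (Bin A l r) = 1 \<or> rdepth (Bin A l r) = Suc (ldepth l) \<and> ldepth l > 0 \<or>
      rdepth (Bin A l r) = rdepth r \<and> rdepth r > 0"
      by (auto simp: max_def)
    then show ?case using Bin.IH(1)[of "Incomplete X A # \<sigma>" i] Bin.IH(4)[of \<sigma> X] by (elim disjE conjE) auto }
qed auto

lemma Max_reduce_depths_lmoves:
  assumes "reduce_depths (lmoves T [] 0) \<noteq> {}"
  shows "ldepth T > 0" and "Max (reduce_depths (lmoves T [] 0)) = ldepth T"
proof -
  show "ldepth T > 0"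
    using assms by (cases T) auto
  moreover have "finite (reduce_depths (lmoves T [] 0))"
    using reduce_depths_moves_le(1)[of _ T "[]" 0] by (auto simp: finite_nat_set_iff_bounded_le)
  ultimately show "Max (reduce_depths (lmoves T [] 0)) = ldepth T"
    using reduce_depths_moves_le(1)[of _ T "[]" 0] depth_in_reduce_depths_moves(1)[of T "[]" 0]
    by (intro Max_eqI) auto
qed


section \<open>Uniqueness of the transition sequence\<close>

fun closed :: "('n, 't) tree \<Rightarrow> bool" where
  "closed (Open A) \<longleftrightarrow> False"
| "closed (Lex A a) \<longleftrightarrow> True"
| "closed (Bin A l r) \<longleftrightarrow> closed l \<and> closed r"

text \<open>A bare \<open>Open B\<close> is excluded: PREDICTION always puts an inner node above the
  open leaf, so that filling the leaf never yields a bare lexical tree. This tells SCAN from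
  SHIFT.\<close>

fun partial :: "'n \<Rightarrow> ('n, 't) tree \<Rightarrow> bool" where
  "partial B (Open A) \<longleftrightarrow> False"
| "partial B (Lex A a) \<longleftrightarrow> False"
| "partial B (Bin A l r) \<longleftrightarrow> closed l \<and> (r = Open B \<or> partial B r)"

fun represents :: "'n stack_symbol \<Rightarrow> ('n, 't) tree \<Rightarrow> bool" where
  "represents (Complete A) t \<longleftrightarrow> closed t \<and> root t = A"
| "represents (Incomplete A B) t \<longleftrightarrow> partial B t \<and> root t = A"

text \<open>Read off the trees alone, without input or stack symbols, so that a transition can be
  undone from the trees it has produced.\<close>

fun applicable :: "('n, 't) transition \<Rightarrow> ('n, 't) tree list \<Rightarrow> bool" where
  "applicable (Shift A a) \<tau> \<longleftrightarrow> True"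
| "applicable (Scan B a) (t # \<tau>) \<longleftrightarrow> partial B t"
| "applicable (Prediction B A C) (t # \<tau>) \<longleftrightarrow> closed t \<and> root t = A"
| "applicable (Composition B C D) (t # u # \<tau>) \<longleftrightarrow> closed t \<and> root t = C \<and> partial B u"
| "applicable _ _ \<longleftrightarrow> False"

lemma expand_open_partial:
  assumes "partial B t"
  shows "root (expand_open t s) = root t" and "closed (expand_open t s) \<longleftrightarrow> closed s"
    and "partial C s \<Longrightarrow> partial C (expand_open t s)" and "\<exists>A l r. expand_open t s = Bin A l r"
    and "expand_open t s = Bin A l (Open D) \<Longrightarrow> s = Open D"
proof -
  show "root (expand_open t s) = root t"
    using assms by (cases t) auto
  have bin: "\<exists>A l r. expand_open t s = Bin A l r" if "partial B t" for t
    using that by (cases t) auto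
  then show "\<exists>A l r. expand_open t s = Bin A l r"
    using assms .
  show "closed (expand_open t s) \<longleftrightarrow> closed s"
    using assms by (induction t) auto
  show "partial C s \<Longrightarrow> partial C (expand_open t s)"
    using assms by (induction t) auto
  show "expand_open t s = Bin A l (Open D) \<Longrightarrow> s = Open D"
    using assms bin by (cases t) fastforce+
qed

text \<open>The inserted piece can be located again, since it ends the right spine: as a lexical
  leaf or as a node with an open right child. If one tree had its open leaf higher than the other,
  the higher piece would be an expansion of a partial tree with an open right child at its root,
  which \<open>expand_open_partial\<close> rules out.\<close>

lemma expand_open_inject:
  assumes "partial B t" and "partial B' t'"
    and "(\<exists>a. s = Lex B a) \<or> (\<exists>l D. s = Bin B l (Open D))"
    and "(\<exists>a. s' = Lex B' a) \<or> (\<exists>l D. s' = Bin B' l (Open D))"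
    and "expand_open t s = expand_open t' s'"
  shows "t = t' \<and> s = s'"
  using assms
proof (induction t arbitrary: t')
  case (Bin A l r)
  then obtain r' where t': "t' = Bin A l r'"
    by (cases t') auto
  have eq: "expand_open r s = expand_open r' s'"
    using Bin.prems(5) t' by simp
  show ?case
  proof (cases "r = Open B")
    case True
    moreover have "\<not> partial B' r'"
    proof
      assume "partial B' r'"
      then show False
        using eq True expand_open_partial(4,5)[of B' r' s'] Bin.prems(3,4) by auto
    qed
    ultimately show ?thesis
      using Bin.prems eq t' by auto
  next
    case False
    then have r: "partial B r"
      using Bin.prems(1) by simp
    moreover have "r' \<noteq> Open B'"
      using eq expand_open_partial(4,5)[OF r, of s] Bin.prems(3,4) by auto
    ultimately show ?thesis
      using Bin.IH(2)[of r'] Bin.prems eq t' by auto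
  qed
qed auto

text \<open>Separates SCAN and COMPOSITION, which change the tree below its root, from SHIFT and
  PREDICTION, which create the root.\<close>

lemma expand_open_neq:
  "partial B t \<Longrightarrow> expand_open t (Lex B b) \<noteq> Lex A a"
  "partial B t \<Longrightarrow> expand_open t (Bin B l (Open D)) \<noteq> Lex A a"
  "partial B t \<Longrightarrow> expand_open t (Lex B b) \<noteq> Bin A l' (Open C)"
  "partial B t \<Longrightarrow> expand_open t (Bin B l (Open D)) \<noteq> Bin A l' (Open C)"
  using expand_open_partial(4)[of B t "Lex B b"]
    expand_open_partial(4)[of B t "Bin B l (Open D)"]
    expand_open_partial(5)[of B t "Lex B b" A l' C]
    expand_open_partial(5)[of B t "Bin B l (Open D)" A l' C]
  by auto

lemma expand_open_eq_iff:
  assumes "partial B t" and "partial B' t'"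
  shows "expand_open t (Lex B a) = expand_open t' (Lex B' a') \<longleftrightarrow> t = t' \<and> B = B' \<and> a = a'"
    and "expand_open t (Lex B a) \<noteq> expand_open t' (Bin B' l' (Open D'))"
    and "expand_open t (Bin B l (Open D)) \<noteq> expand_open t' (Lex B' a')"
    and "expand_open t (Bin B l (Open D)) = expand_open t' (Bin B' l' (Open D')) \<longleftrightarrow>
      t = t' \<and> B = B' \<and> l = l' \<and> D = D'"
  using expand_open_inject[OF assms, of "Lex B a" "Lex B' a'"]
    expand_open_inject[OF assms, of "Lex B a" "Bin B' l' (Open D')"]
    expand_open_inject[OF assms, of "Bin B l (Open D)" "Lex B' a'"]
    expand_open_inject[OF assms, of "Bin B l (Open D)" "Bin B' l' (Open D')"]
  by auto

lemma build_inject: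
  assumes "applicable x \<tau>" and "applicable y \<tau>'" and "build x \<tau> = build y \<tau>'"
  shows "x = y \<and> \<tau> = \<tau>'"
  using assms
  by (cases "(x, \<tau>)" rule: applicable.cases; cases "(y, \<tau>')" rule: applicable.cases)
    (auto simp: expand_open_neq expand_open_neq[symmetric] expand_open_eq_iff)

lemma lc_step_represents:
  assumes "lc_step G w x c d" and "list_all2 represents (fst c) \<tau>"
  shows "applicable x \<tau> \<and> list_all2 represents (fst d) (build x \<tau>)"
  using assms
  by cases (auto simp: list_all2_Cons1 expand_open_partial(1-3))

fun applicable_seq :: "('n, 't) transition list \<Rightarrow> ('n, 't) tree list \<Rightarrow> bool" where
  "applicable_seq [] \<tau> \<longleftrightarrow> True"
| "applicable_seq (x # xs) \<tau> \<longleftrightarrow> applicable x \<tau> \<and> applicable_seq xs (build x \<tau>)"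

lemma applicable_seq_append:
  "applicable_seq (xs @ ys) \<tau> \<longleftrightarrow> applicable_seq xs \<tau> \<and> applicable_seq ys (fold build xs \<tau>)"
  by (induction xs arbitrary: \<tau>) auto

lemma lc_run_applicable:
  "lc_run G w c \<rho> c' \<Longrightarrow> list_all2 represents (fst c) \<tau> \<Longrightarrow> applicable_seq (map fst \<rho>) \<tau>"
proof (induction \<rho> arbitrary: c \<tau>)
  case (Cons z \<rho>)
  then obtain x d where "z = (x, d)" "lc_step G w x c d" "lc_run G w d \<rho> c'"
    by (cases z) auto
  then show ?case
    using lc_step_represents[of G w x c d \<tau>] Cons.prems Cons.IH[of d "build x \<tau>"] by simp
qed simp

lemma build_neq_Nil: "applicable x \<tau> \<Longrightarrow> build x \<tau> \<noteq> []"
  by (cases "(x, \<tau>)" rule: applicable.cases) auto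

text \<open>Both sequences are read backwards: the final trees determine the last transition and the
  trees before it, and no transition leads to the empty list.\<close>

lemma applicable_seq_unique:
  assumes "applicable_seq xs []" and "applicable_seq ys []"
    and "fold build xs [] = fold build ys []"
  shows "xs = ys"
  using assms
proof (induction xs arbitrary: ys rule: rev_induct)
  case Nil
  then show ?case
    by (cases ys rule: rev_cases) (auto simp: applicable_seq_append dest: build_neq_Nil)
next
  case (snoc x xs)
  then obtain y ys' where "ys = ys' @ [y]"
    by (cases ys rule: rev_cases) (auto simp: applicable_seq_append dest: build_neq_Nil)
  then show ?case
    using snoc.prems snoc.IH[of ys'] build_inject[of x "fold build xs []" y "fold build ys' []"]
    by (simp add: applicable_seq_append)
qed

lemma lc_step_deterministic:
  "lc_step G w x c d \<Longrightarrow> lc_step G w x c d' \<Longrightarrow> d = d'"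
  by (elim lc_step.cases) simp_all

lemma lc_run_unique:
  assumes "lc_run G w c \<rho> c'" and "lc_run G w c \<rho>' c''" and "map fst \<rho> = map fst \<rho>'"
  shows "\<rho> = \<rho>'"
  using assms
proof (induction \<rho> arbitrary: c \<rho>')
  case (Cons z \<rho>)
  then obtain x d d' \<rho>'' where "z = (x, d)" "\<rho>' = (x, d') # \<rho>''"
    by (cases z; cases \<rho>') auto
  moreover from this have "d = d'"
    using Cons.prems lc_step_deterministic[of G w x c d d'] by simp
  ultimately show ?case
    using Cons.IH[of d \<rho>''] Cons.prems by simp
qed simp

lemma recognizes_unique:
  assumes "recognizes G T \<rho>" and "recognizes G T \<rho>'"
  shows "\<rho> = \<rho>'"
proof -
  have "applicable_seq (map fst \<rho>) []" "applicable_seq (map fst \<rho>') []"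
    using assms lc_run_applicable[of G "yield T" "([], 0)" _ _ "[]"]
    unfolding recognizes_def by (metis fst_conv list_all2_Nil)+
  then have "map fst \<rho> = map fst \<rho>'"
    using assms by (intro applicable_seq_unique) (simp_all add: recognizes_def)
  then show ?thesis
    using assms lc_run_unique unfolding recognizes_def by blast
qed


section \<open>Derivations of the node grammar\<close>

fun subtree :: "('n, 't) tree \<Rightarrow> node \<Rightarrow> ('n, 't) tree option" where
  "subtree t [] = Some t"
| "subtree (Bin A l r) (L # p) = subtree l p"
| "subtree (Bin A l r) (R # p) = subtree r p"
| "subtree t p = None"

lemma subtree_append:
  "subtree t (p @ q) = (case subtree t p of None \<Rightarrow> None | Some s \<Rightarrow> subtree s q)"
  by (induction t p rule: subtree.induct) (auto split: option.splits)

lemma subtree_parse: "parse_subtree G t \<Longrightarrow> subtree t p = Some s \<Longrightarrow> parse_subtree G s"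
  by (induction t p rule: subtree.induct) auto

lemma yield_parse_neq_Nil: "parse_subtree G t \<Longrightarrow> yield t \<noteq> []"
  by (induction t) auto

lemma node_rules_iff:
  "(p, \<gamma>) \<in> node_rules q t \<longleftrightarrow>
     (\<exists>p'. p = q @ p' \<and>
        ((\<exists>A a. subtree t p' = Some (Lex A a) \<and> \<gamma> = [Tm a]) \<or>
         (\<exists>A l r. subtree t p' = Some (Bin A l r) \<and> \<gamma> = [NT (p @ [L]), NT (p @ [R])])))"
  (is "_ \<longleftrightarrow> ?rhs q t")
proof (induction t arbitrary: q)
  case (Open A)
  have "subtree (Open A) p' = Some s \<longleftrightarrow> p' = [] \<and> s = Open A" for p' s
    by (cases p') auto
  then show ?case by auto
next
  case (Lex A a)
  have "subtree (Lex A a) p' = Some s \<longleftrightarrow> p' = [] \<and> s = Lex A a" for p' s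
    by (cases p') auto
  then show ?case by auto
next
  case (Bin A l r)
  have "?rhs q (Bin A l r) \<longleftrightarrow>
      p = q \<and> \<gamma> = [NT (q @ [L]), NT (q @ [R])] \<or> ?rhs (q @ [L]) l \<or> ?rhs (q @ [R]) r"
    (is "?a \<longleftrightarrow> ?b")
  proof
    assume ?a
    then obtain p' where p': "p = q @ p'"
      "(\<exists>B a. subtree (Bin A l r) p' = Some (Lex B a) \<and> \<gamma> = [Tm a]) \<or>
       (\<exists>B l' r'. subtree (Bin A l r) p' = Some (Bin B l' r') \<and> \<gamma> = [NT (p @ [L]), NT (p @ [R])])"
      by blast
    consider "p' = []" | d where "p' = L # d" | d where "p' = R # d"
      by (metis direction.exhaust neq_Nil_conv)
    then show ?b using p' by cases auto
  next
    assume ?b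
    then show ?a
      apply (elim disjE exE conjE)
      subgoal by (auto intro!: exI[of _ "[]"])
      subgoal for p' by (auto intro!: exI[of _ "L # p'"])
      subgoal for p' by (auto intro!: exI[of _ "L # p'"])
      subgoal for p' by (auto intro!: exI[of _ "R # p'"])
      subgoal for p' by (auto intro!: exI[of _ "R # p'"])
      done
  qed
  then show ?case using Bin.IH by auto
qed

abbreviation node_step ::
  "('n, 't) tree \<Rightarrow> (node, 't) symbol list \<Rightarrow> (node, 't) symbol list \<Rightarrow> bool" where
  "node_step T \<equiv> lm_step (node_grammar T)"

lemma map_Tm_append_eq:
  "map Tm v @ x = map Tm u @ NT A # \<alpha> \<Longrightarrow> \<exists>u'. u = v @ u' \<and> x = map Tm u' @ NT A # \<alpha>"
proof (induction v arbitrary: u)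
  case (Cons a v)
  then show ?case by (cases u) auto
qed simp

text \<open>The left-most nonterminal lies behind every terminal prefix. This allows the prefixes of
  a center-embedding to be stripped off.\<close>

lemma lm_step_prefix:
  "lm_step H (map Tm v @ x) y \<longleftrightarrow> (\<exists>y'. y = map Tm v @ y' \<and> lm_step H x y')"
proof
  assume "lm_step H (map Tm v @ x) y"
  then show "\<exists>y'. y = map Tm v @ y' \<and> lm_step H x y'"
  proof cases
    case (1 A \<gamma> u \<alpha>)
    obtain u' where u': "u = v @ u'" "x = map Tm u' @ NT A # \<alpha>"
      using map_Tm_append_eq[OF 1(1)] by blast
    moreover have "lm_step H x (map Tm u' @ \<gamma> @ \<alpha>)"
      unfolding u'(2) using 1(3) by (rule lm_step.intros)
    ultimately show ?thesis
      using 1(2) by simp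
  qed
next
  assume "\<exists>y'. y = map Tm v @ y' \<and> lm_step H x y'"
  then obtain y' where y': "y = map Tm v @ y'" "lm_step H x y'"
    by blast
  from y'(2) show "lm_step H (map Tm v @ x) y"
  proof cases
    case (1 A \<gamma> u \<alpha>)
    have "lm_step H (map Tm (v @ u) @ NT A # \<alpha>) (map Tm (v @ u) @ \<gamma> @ \<alpha>)"
      using 1(3) by (rule lm_step.intros)
    then show ?thesis
      using 1(1,2) y'(1) by simp
  qed
qed

lemma lm_steps_prefix_ex:
  "(lm_step H)\<^sup>*\<^sup>* (map Tm v @ x) z \<Longrightarrow> \<exists>y. z = map Tm v @ y \<and> (lm_step H)\<^sup>*\<^sup>* x y"
  by (induction rule: rtranclp_induct) (auto simp: lm_step_prefix intro: rtranclp.intros)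

lemma lm_steps_prefix:
  "(lm_step H)\<^sup>*\<^sup>* (map Tm v @ x) (map Tm v @ y) \<longleftrightarrow> (lm_step H)\<^sup>*\<^sup>* x y"
proof
  show "(lm_step H)\<^sup>*\<^sup>* (map Tm v @ x) (map Tm v @ y) \<Longrightarrow> (lm_step H)\<^sup>*\<^sup>* x y"
    by (auto dest: lm_steps_prefix_ex)
next
  show "(lm_step H)\<^sup>*\<^sup>* x y \<Longrightarrow> (lm_step H)\<^sup>*\<^sup>* (map Tm v @ x) (map Tm v @ y)"
    by (induction rule: rtranclp_induct) (auto simp: lm_step_prefix intro: rtranclp.intros)
qed

lemma lm_stepsp_prefix:
  "(lm_step H)\<^sup>+\<^sup>+ (map Tm v @ x) (map Tm v @ y) \<longleftrightarrow> (lm_step H)\<^sup>+\<^sup>+ x y"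
  by (auto simp: tranclp_unfold_left relcompp_apply lm_step_prefix lm_steps_prefix)

lemma lm_step_NT_cases:
  assumes "lm_step H x y"
  obtains v p \<alpha> y' where "x = map Tm v @ NT p # \<alpha>" "y = map Tm v @ y'" "lm_step H (NT p # \<alpha>) y'"
  using assms
proof cases
  case (1 p \<gamma> v \<alpha>)
  then show ?thesis
    using assms that lm_step_prefix by blast
qed

lemma node_step_NT_iff:
  "node_step T (NT p # \<alpha>) y \<longleftrightarrow>
     (\<exists>A a. subtree T p = Some (Lex A a) \<and> y = Tm a # \<alpha>) \<or>
     (\<exists>A l r. subtree T p = Some (Bin A l r) \<and> y = NT (p @ [L]) # NT (p @ [R]) # \<alpha>)"
proof -
  have "node_step T (NT p # \<alpha>) y \<longleftrightarrow> (\<exists>\<gamma>. (p, \<gamma>) \<in> node_rules [] T \<and> y = \<gamma> @ \<alpha>)"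
    (is "?a \<longleftrightarrow> ?b")
  proof
    assume ?a
    then show ?b
    proof cases
      case (1 A \<gamma> v \<beta>)
      then show ?thesis by (cases v) (auto simp: node_grammar_def)
    qed
  next
    assume ?b
    then show ?a
      using lm_step.intros[of p _ "node_grammar T" "[]" \<alpha>] by (auto simp: node_grammar_def)
  qed
  then show ?thesis by (auto simp: node_rules_iff)
qed

lemma node_steps_yield:
  assumes "subtree T p = Some t" and "parse_subtree G t"
  shows "(node_step T)\<^sup>+\<^sup>+ (NT p # \<alpha>) (map Tm (yield t) @ \<alpha>)"
  using assms
proof (induction t arbitrary: p \<alpha>)
  case (Lex A a)
  then show ?case by (auto simp: node_step_NT_iff)
next
  case (Bin A l r)
  have "node_step T (NT p # \<alpha>) (NT (p @ [L]) # NT (p @ [R]) # \<alpha>)"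
    using Bin.prems by (simp add: node_step_NT_iff)
  also have "(node_step T)\<^sup>+\<^sup>+ \<dots> (map Tm (yield l) @ NT (p @ [R]) # \<alpha>)"
    using Bin.prems by (intro Bin.IH) (auto simp: subtree_append)
  also have "(node_step T)\<^sup>+\<^sup>+ \<dots> (map Tm (yield l) @ map Tm (yield r) @ \<alpha>)"
    unfolding lm_stepsp_prefix using Bin.prems by (intro Bin.IH) (auto simp: subtree_append)
  finally show ?case by simp
qed auto

lemma node_steps_right_child:
  assumes "subtree T p = Some (Bin A l r)" and "parse_subtree G l"
  shows "(node_step T)\<^sup>+\<^sup>+ (NT p # \<alpha>) (map Tm (yield l) @ NT (p @ [R]) # \<alpha>)"
proof -
  have "node_step T (NT p # \<alpha>) (NT (p @ [L]) # NT (p @ [R]) # \<alpha>)"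
    using assms by (simp add: node_step_NT_iff)
  also have "(node_step T)\<^sup>+\<^sup>+ \<dots> (map Tm (yield l) @ NT (p @ [R]) # \<alpha>)"
    using assms by (intro node_steps_yield) (auto simp: subtree_append)
  finally show ?thesis .
qed

text \<open>Excludes paths of length 0 where one or more steps are required. A lexical step turns
  weight 1 into weight 2, a binary step adds a symbol of weight 1.\<close>

lemma node_stepsp_neq:
  fixes T :: "('n, 't) tree"
  assumes "(node_step T)\<^sup>+\<^sup>+ x y"
  shows "x \<noteq> y"
proof -
  \<comment> \<open>a measure that increases in every step\<close>
  define \<mu> where "\<mu> x = sum_list (map (\<lambda>X. case X of NT p \<Rightarrow> 1 | Tm a \<Rightarrow> (2::nat)) x)"
    for x :: "(node, 't) symbol list"
  have step: "\<mu> x < \<mu> y" if "node_step T x y" for x y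
    using that by (rule lm_step_NT_cases) (auto simp: node_step_NT_iff \<mu>_def)
  from assms have "\<mu> x < \<mu> y"
    by (induction rule: tranclp_induct) (auto dest: step less_trans)
  then show ?thesis by auto
qed

text \<open>The type \<open>node\<close> also contains addresses outside \<open>T\<close>;
  derivations from the root never reach them.\<close>

definition valid_form :: "('n, 't) tree \<Rightarrow> (node, 't) symbol list \<Rightarrow> bool" where
  "valid_form T x \<longleftrightarrow> (\<forall>p. NT p \<in> set x \<longrightarrow> subtree T p \<noteq> None)"

lemma valid_form_node_step: "node_step T x y \<Longrightarrow> valid_form T x \<Longrightarrow> valid_form T y"
  by (erule lm_step_NT_cases) (auto simp: node_step_NT_iff valid_form_def subtree_append)

lemma valid_form_node_steps: "(node_step T)\<^sup>*\<^sup>* x y \<Longrightarrow> valid_form T x \<Longrightarrow> valid_form T y"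
  by (induction rule: rtranclp_induct) (auto dest: valid_form_node_step)

text \<open>An invariant of derivations, from which the words produced between two nodes are
  recovered. Addresses outside \<open>T\<close> count as empty.\<close>

definition sentence :: "('n, 't) tree \<Rightarrow> (node, 't) symbol list \<Rightarrow> 't list" where
  "sentence T x = concat (map (\<lambda>X. case X of Tm a \<Rightarrow> [a]
     | NT p \<Rightarrow> (case subtree T p of Some t \<Rightarrow> yield t | None \<Rightarrow> [])) x)"

lemma sentence_simps [simp]:
  "sentence T [] = []"
  "sentence T (Tm a # x) = a # sentence T x"
  "sentence T (NT p # x) =
     (case subtree T p of Some t \<Rightarrow> yield t | None \<Rightarrow> []) @ sentence T x"
  "sentence T (x @ y) = sentence T x @ sentence T y"
  "sentence T (map Tm v) = v"
  by (auto simp: sentence_def comp_def)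

lemma sentence_node_step: "node_step T x y \<Longrightarrow> sentence T y = sentence T x"
  by (erule lm_step_NT_cases) (auto simp: node_step_NT_iff subtree_append)

lemma sentence_node_steps: "(node_step T)\<^sup>*\<^sup>* x y \<Longrightarrow> sentence T y = sentence T x"
  by (induction rule: rtranclp_induct) (auto dest: sentence_node_step)

text \<open>The right siblings of the nodes on the path \<open>q\<close> below the node \<open>p\<close>, lowest first.\<close>

fun pending :: "node \<Rightarrow> node \<Rightarrow> node list" where
  "pending p [] = []"
| "pending p (L # q) = pending (p @ [L]) q @ [p @ [R]]"
| "pending p (R # q) = pending (p @ [R]) q"

lemma pending_snoc:
  "pending p (q @ [L]) = (p @ q @ [R]) # pending p q"
  "pending p (q @ [R]) = pending p q"
  by (induction p q rule: pending.induct) auto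

text \<open>The next node to expand is found by turning right at the last left edge of the
  path.\<close>

lemma pending_Cons:
  assumes "pending p q = x # xs"
  shows "\<exists>q' q''. q = q' @ L # q'' \<and> x = p @ q' @ [R] \<and> xs = pending p q'"
  using assms
proof (induction q rule: rev_induct)
  case (snoc d q)
  then show ?case
    by (cases d) (force simp: pending_snoc)+
qed simp

lemma pending_Nil: "pending p q = [] \<Longrightarrow> q = replicate (length q) R"
  by (induction p q rule: pending.induct) auto

text \<open>A left-most derivation is a depth-first traversal: until the subtree at \<open>p\<close>
  is finished, the form is determined by the current path \<open>q\<close> and the words read, and
  \<open>\<alpha>\<close> stays untouched.\<close>

lemma node_steps_NT:
  assumes "(node_step T)\<^sup>*\<^sup>* (NT p # \<alpha>) x" and "subtree T p = Some t"
  shows "(\<exists>u q s. x = map Tm u @ NT (p @ q) # map NT (pending p q) @ \<alpha> \<and> subtree t q = Some s) \<or>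
    (\<exists>y. x = map Tm (yield t) @ y)"
  using assms(1)
proof (induction rule: rtranclp_induct)
  case base
  show ?case by (rule disjI1, rule exI[of _ "[]"], rule exI[of _ "[]"]) simp
next
  case (step x x')
  from step.IH show ?case
  proof (elim disjE exE conjE)
    fix y
    assume "x = map Tm (yield t) @ y"
    then show ?thesis using step.hyps(2) by (auto simp: lm_step_prefix)
  next
    fix u q s
    assume x: "x = map Tm u @ NT (p @ q) # map NT (pending p q) @ \<alpha>" and s: "subtree t q = Some s"
    have pq: "subtree T (p @ q) = Some s"
      using assms(2) s by (simp add: subtree_append)
    obtain y where y: "x' = map Tm u @ y" "node_step T (NT (p @ q) # map NT (pending p q) @ \<alpha>) y"
      using step.hyps(2) x by (auto simp: lm_step_prefix)
    from y(2) show ?thesis unfolding node_step_NT_iff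
    proof (elim disjE exE conjE)
      fix A a
      assume a: "subtree T (p @ q) = Some (Lex A a)" "y = Tm a # map NT (pending p q) @ \<alpha>"
      show ?thesis
      proof (cases "pending p q")
        case Nil
        \<comment> \<open>Nothing is pending, so this leaf completes the subtree; the invariant
          identifies the words read with its yield.\<close>
        have "sentence T x' = sentence T (NT p # \<alpha>)"
          using step.hyps by (intro sentence_node_steps) simp
        then have "u @ [a] = yield t"
          using a y Nil assms(2) by simp
        then show ?thesis
          using a y Nil by (intro disjI2 exI[of _ \<alpha>]) (auto simp flip: \<open>u @ [a] = yield t\<close>)
      next
        case (Cons z zs)
        then obtain q' q'' where q: "q = q' @ L # q''" "z = p @ q' @ [R]" "zs = pending p q'"
          using pending_Cons by blast
        have "\<exists>s'. subtree t (q' @ [R]) = Some s'"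
          using s q(1) by (auto simp: subtree_append split: option.splits elim!: subtree.elims)
        then show ?thesis
          using a y Cons q
          by (intro disjI1 exI[of _ "u @ [a]"] exI[of _ "q' @ [R]"]) (auto simp: pending_snoc)
      qed
    next
      fix A l r
      assume "subtree T (p @ q) = Some (Bin A l r)"
        "y = NT ((p @ q) @ [L]) # NT ((p @ q) @ [R]) # map NT (pending p q) @ \<alpha>"
      then show ?thesis
        using y pq s
        by (intro disjI1 exI[of _ u] exI[of _ "q @ [L]"]) (auto simp: pending_snoc subtree_append)
    qed
  qed
qed

lemma map_Tm_NT_eq_iff:
  "map Tm u @ NT p # \<alpha> = map Tm v @ NT q # \<beta> \<longleftrightarrow> u = v \<and> p = q \<and> \<alpha> = \<beta>"
proof
  assume "map Tm u @ NT p # \<alpha> = map Tm v @ NT q # \<beta>"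
  then show "u = v \<and> p = q \<and> \<alpha> = \<beta>"
  proof (induction u arbitrary: v)
    case Nil
    then show ?case by (cases v) auto
  next
    case (Cons a u)
    then show ?case by (cases v) auto
  qed
qed simp

text \<open>As the suffix is again \<open>\<alpha>\<close>, no right sibling is pending, so the path
  has no left edge. A node beyond the subtree at \<open>p\<close> would have an empty yield.\<close>

lemma node_steps_right:
  assumes "(node_step T)\<^sup>+\<^sup>+ (NT p # \<alpha>) (map Tm w @ NT q # \<alpha>)" and "parse_subtree G T"
    and p: "subtree T p = Some t" and q: "subtree T q = Some s"
  shows "\<exists>k > 0. q = p @ replicate k R"
proof -
  have steps: "(node_step T)\<^sup>*\<^sup>* (NT p # \<alpha>) (map Tm w @ NT q # \<alpha>)"
    using assms(1) by (rule tranclp_into_rtranclp)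
  have yields: "w @ yield s = yield t"
    using sentence_node_steps[OF steps] p q by simp
  show ?thesis
    using node_steps_NT[OF steps p]
  proof (elim disjE exE conjE)
    fix u q' s'
    assume "map Tm w @ NT q # \<alpha> = map Tm u @ NT (p @ q') # map NT (pending p q') @ \<alpha>"
    then have "q = p @ q'" "pending p q' = []"
      by (auto simp: map_Tm_NT_eq_iff)
    then have k: "q = p @ replicate (length q') R"
      using pending_Nil by metis
    moreover have "length q' > 0"
    proof (rule ccontr)
      assume "\<not> length q' > 0"
      then have "q = p" using k by simp
      then have "w = []" using yields p q by simp
      then show False
        using node_stepsp_neq[OF assms(1)] \<open>q = p\<close> by simp
    qed
    ultimately show ?thesis by blast
  next
    fix y
    assume "map Tm w @ NT q # \<alpha> = map Tm (yield t) @ y"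
    then obtain w' where "w = yield t @ w'"
      using map_Tm_append_eq by metis
    then have "yield s = []"
      using yields by simp
    then show ?thesis
      using yield_parse_neq_Nil[of G s] subtree_parse[of G T q s] assms(2) q by simp
  qed
qed

text \<open>No terminal has been produced, and following left children is the only way to keep a
  nonterminal in front.\<close>

lemma node_steps_left:
  assumes "(node_step T)\<^sup>+\<^sup>+ (NT p # \<alpha>) (NT q # \<beta>)"
  shows "\<exists>k > 0. q = p @ replicate k L"
proof -
  have "(node_step T)\<^sup>+\<^sup>+ (NT p # \<alpha>) x \<Longrightarrow>
    (\<exists>k \<beta>. k > 0 \<and> x = NT (p @ replicate k L) # \<beta>) \<or> (\<exists>a y. x = map Tm [a] @ y)" for x
  proof (induction rule: tranclp_induct)
    case (base x)
    then show ?case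
      by (auto simp: node_step_NT_iff intro: exI[of _ 1])
  next
    case (step x x')
    from step.IH show ?case
    proof (elim disjE exE conjE)
      fix k \<beta>
      assume "x = NT (p @ replicate k L) # \<beta>"
      moreover have "(p @ replicate k L) @ [L] = p @ replicate (Suc k) L"
        by (simp add: replicate_append_same)
      ultimately show ?thesis
        using step.hyps(2) by (auto simp: node_step_NT_iff simp del: append_assoc replicate_Suc)
    next
      fix a y
      assume "x = map Tm [a] @ y"
      then show ?thesis using step.hyps(2) by (auto simp only: lm_step_prefix)
    qed
  qed
  from this[OF assms] show ?thesis by auto
qed


section \<open>Center-embedding and stack depth\<close>

lemma rdepth_replicate_R: "subtree t (replicate k R) = Some s \<Longrightarrow> rdepth s \<le> rdepth t"
proof (induction k arbitrary: t)
  case (Suc k)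
  then show ?case by (cases t) fastforce+
qed simp

lemma ldepth_subtree: "subtree t p = Some s \<Longrightarrow> ldepth s \<le> ldepth t"
proof (induction t p rule: subtree.induct)
  case (3 A l r p)
  then show ?case using ldepth_le_rdepth[of r] by auto
qed auto

text \<open>Fails for \<open>k = 0\<close>: \<open>rdepth\<close> enters \<open>ldepth\<close> only
  through a right edge.\<close>

lemma rdepth_le_ldepth:
  assumes "subtree t (replicate k R) = Some s" and "k > 0"
  shows "rdepth s \<le> ldepth t"
  using assms by (cases k; cases t) (auto dest: rdepth_replicate_R)

lemma ldepth_less_rdepth:
  assumes "subtree t (replicate k L) = Some s" and "k > 0"
  shows "ldepth s < rdepth t"
  using assms by (cases k; cases t) (auto dest: ldepth_subtree)

text \<open>
  A prefix of the derivation of a center-embedding, up to the node \<open>C\<^sub>m\<close> (up to \<open>A\<close> if \<open>m = 0\<close>).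
\<close>

inductive reach :: "('n, 't) tree \<Rightarrow> nat \<Rightarrow> 't list \<Rightarrow> node \<Rightarrow> (node, 't) symbol list \<Rightarrow> bool"
  for T :: "('n, 't) tree" where
  reach_0: "(node_step T)\<^sup>*\<^sup>* [NT []] (map Tm v @ NT A # \<alpha>) \<Longrightarrow> reach T 0 v A \<alpha>"
| reach_Suc: "\<lbrakk>reach T m v C \<alpha>;
    (node_step T)\<^sup>+\<^sup>+ (map Tm v @ NT C # \<alpha>) (map Tm (v @ w) @ NT B # \<alpha>);
    (node_step T)\<^sup>+\<^sup>+ (map Tm (v @ w) @ NT B # \<alpha>) (map Tm (v @ w) @ NT C' # \<beta> @ \<alpha>)\<rbrakk> \<Longrightarrow>
    reach T (Suc m) (v @ w) C' (\<beta> @ \<alpha>)"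

lemma reach_valid_form: "reach T m v C \<alpha> \<Longrightarrow> valid_form T (map Tm v @ NT C # \<alpha>)"
proof (induction rule: reach.induct)
  case (reach_0 v A \<alpha>)
  then show ?case by (rule valid_form_node_steps) (simp add: valid_form_def)
next
  case (reach_Suc m v C \<alpha> w B C' \<beta>)
  then show ?case by (meson tranclp_into_rtranclp valid_form_node_steps)
qed

text \<open>Each level uses up at least one unit of \<open>ldepth\<close>: the right edges give
  \<open>rdepth b \<le> ldepth c\<close>, the left edges after them
  \<open>ldepth c' < rdepth b\<close>.\<close>

lemma reach_le_ldepth:
  assumes "reach T m v C \<alpha>" and "parse_subtree G T"
  shows "\<exists>s. subtree T C = Some s \<and> m + ldepth s \<le> ldepth T"
  using assms(1)
proof (induction rule: reach.induct)
  case (reach_0 v A \<alpha>)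
  then have "valid_form T (map Tm v @ NT A # \<alpha>)"
    by (rule reach_valid_form[OF reach.reach_0])
  then obtain s where "subtree T A = Some s"
    by (auto simp: valid_form_def)
  then show ?case
    by (simp add: ldepth_subtree)
next
  case (reach_Suc m v C \<alpha> w B C' \<beta>)
  have "valid_form T (map Tm (v @ w) @ NT B # \<alpha>)"
    using reach_Suc.hyps(1,2) reach_valid_form by (meson tranclp_into_rtranclp valid_form_node_steps)
  then obtain b where b: "subtree T B = Some b"
    by (auto simp: valid_form_def)
  have "valid_form T (map Tm (v @ w) @ NT C' # \<beta> @ \<alpha>)"
    using reach_Suc.hyps by (rule reach_valid_form[OF reach.reach_Suc])
  then obtain c' where c': "subtree T C' = Some c'"
    by (auto simp: valid_form_def)
  obtain c where c: "subtree T C = Some c" "m + ldepth c \<le> ldepth T"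
    using reach_Suc.IH by blast
  have "(node_step T)\<^sup>+\<^sup>+ (NT C # \<alpha>) (map Tm w @ NT B # \<alpha>)"
    using reach_Suc.hyps(2) by (simp add: lm_stepsp_prefix)
  then obtain k where "k > 0" "B = C @ replicate k R"
    using node_steps_right assms(2) c(1) b by blast
  then have "rdepth b \<le> ldepth c"
    using b c(1) by (intro rdepth_le_ldepth) (auto simp: subtree_append)
  moreover have "(node_step T)\<^sup>+\<^sup>+ (NT B # \<alpha>) (NT C' # \<beta> @ \<alpha>)"
    using reach_Suc.hyps(3) unfolding lm_stepsp_prefix .
  then obtain j where "j > 0" "C' = B @ replicate j L"
    using node_steps_left by blast
  then have "ldepth c' < rdepth b"
    using b c' by (intro ldepth_less_rdepth) (auto simp: subtree_append)
  ultimately show ?case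
    using c(2) c' by simp
qed

text \<open>Left edges are free: at level 0 they lead to another choice of A, later they prolong the
  segment from B to C.\<close>

lemma reach_left_child:
  assumes "reach T m v C \<alpha>" and "subtree T C = Some (Bin A l r)"
  shows "reach T m v (C @ [L]) (NT (C @ [R]) # \<alpha>)"
proof -
  have step: "node_step T (map Tm v @ NT C # \<alpha>) (map Tm v @ NT (C @ [L]) # NT (C @ [R]) # \<alpha>)"
    using assms(2) by (simp add: lm_step_prefix node_step_NT_iff)
  from assms(1) show ?thesis
  proof cases
    case reach_0
    then show ?thesis using step by (auto intro!: reach.reach_0)
  next
    case (reach_Suc m' v' C' \<alpha>' w B \<beta>)
    then have "reach T (Suc m') (v' @ w) (C @ [L]) ((NT (C @ [R]) # \<beta>) @ \<alpha>')"
      using step by (intro reach.reach_Suc) (auto intro: tranclp.trancl_into_trancl)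
    then show ?thesis using reach_Suc by simp
  qed
qed

text \<open>The converse of the bound, by following an argument that attains the maximum. The second
  claim covers a node \<open>B\<close> reached from \<open>C\<close> by right edges, where a level
  has been started but no left edge taken yet. The strict bounds on \<open>k\<close> reserve one
  unit for the final binary node.\<close>

lemma reach_deeper:
  assumes "parse_subtree G s"
  shows "\<lbrakk>reach T m v C \<alpha>; subtree T C = Some s; k < ldepth s\<rbrakk> \<Longrightarrow>
      \<exists>v' C' \<alpha>' A l r. reach T (m + k) v' C' \<alpha>' \<and> subtree T C' = Some (Bin A l r)"
    and "\<lbrakk>reach T m v C \<alpha>; (node_step T)\<^sup>+\<^sup>+ (map Tm v @ NT C # \<alpha>) (map Tm (v @ w) @ NT B # \<alpha>);
        subtree T B = Some s; 0 < k; k < rdepth s\<rbrakk> \<Longrightarrow>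
      \<exists>v' C' \<alpha>' A l r. reach T (m + k) v' C' \<alpha>' \<and> subtree T C' = Some (Bin A l r)"
  using assms
proof (induction s arbitrary: m v C \<alpha> k w B)
  case (Bin A l r)
  { case 1
    have subtrees: "subtree T (C @ [L]) = Some l" "subtree T (C @ [R]) = Some r"
      using 1(2) by (simp_all add: subtree_append)
    consider "k = 0" | "k < ldepth l" | "0 < k" "k < rdepth r"
      using 1(3) by (fastforce simp: less_max_iff_disj)
    then show ?case
    proof cases
      case 1
      then show ?thesis using \<open>reach T m v C \<alpha>\<close> \<open>subtree T C = _\<close> by simp blast
    next
      case 2
      then show ?thesis
        using Bin.IH(1)[OF reach_left_child[OF 1(1,2)] subtrees(1)] 1(4) by simp
    next
      case 3
      have "(node_step T)\<^sup>+\<^sup>+ (map Tm v @ NT C # \<alpha>) (map Tm (v @ yield l) @ NT (C @ [R]) # \<alpha>)"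
        using node_steps_right_child[OF 1(2), where G = G] 1(4) by (simp add: lm_stepsp_prefix)
      then show ?thesis
        using Bin.IH(4)[OF 1(1) _ subtrees(2) 3] 1(4) by simp
    qed }
  { case 2
    have subtrees: "subtree T (B @ [L]) = Some l" "subtree T (B @ [R]) = Some r"
      using 2(3) by (simp_all add: subtree_append)
    \<comment> \<open>Either the left edge is taken here and completes a level, or the right spine
      is followed further.\<close>
    consider "k - 1 < ldepth l" | "k < rdepth r"
      using 2(4,5) by (fastforce simp: less_max_iff_disj)
    then show ?case
    proof cases
      case 1
      have "node_step T (map Tm (v @ w) @ NT B # \<alpha>)
          (map Tm (v @ w) @ NT (B @ [L]) # [NT (B @ [R])] @ \<alpha>)"
        unfolding lm_step_prefix using 2(3) by (auto simp: node_step_NT_iff)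
      then have "reach T (Suc m) (v @ w) (B @ [L]) ([NT (B @ [R])] @ \<alpha>)"
        using 2(1,2) by (intro reach.reach_Suc) (auto intro: tranclp.r_into_trancl)
      then show ?thesis
        using Bin.IH(1)[OF _ subtrees(1) 1, of "Suc m"] 2(4,6) by simp
    next
      case r: 2
      note 2(2)
      also have "(node_step T)\<^sup>+\<^sup>+ (map Tm (v @ w) @ NT B # \<alpha>)
          (map Tm (v @ w) @ map Tm (yield l) @ NT (B @ [R]) # \<alpha>)"
        unfolding lm_stepsp_prefix using node_steps_right_child[OF 2(3), where G = G] 2(6) by simp
      finally show ?thesis
        using Bin.IH(4)[OF 2(1) _ subtrees(2) 2(4) r, of "w @ yield l"] 2(6) by simp
    qed }
qed auto

section \<open>Translation between the indexed definition of center-embedding and its inductive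
  form\<close>

definition chain_prefix :: "'t list \<Rightarrow> (nat \<Rightarrow> 't list) \<Rightarrow> nat \<Rightarrow> 't list" where
  "chain_prefix v w i = v @ concat (map w [1..<Suc i])"

definition chain_suffix :: "'s list \<Rightarrow> (nat \<Rightarrow> 's list) \<Rightarrow> nat \<Rightarrow> 's list" where
  "chain_suffix \<alpha> \<beta> i = concat (map \<beta> (rev [1..<Suc i])) @ \<alpha>"

lemma chain_simps [simp]:
  "chain_prefix v w 0 = v"
  "chain_prefix v w (Suc i) = chain_prefix v w i @ w (Suc i)"
  "chain_suffix \<alpha> \<beta> 0 = \<alpha>"
  "chain_suffix \<alpha> \<beta> (Suc i) = \<beta> (Suc i) @ chain_suffix \<alpha> \<beta> i"
  by (simp_all add: chain_prefix_def chain_suffix_def)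

text \<open>Adding a level overwrites the indexed families only at the new index.\<close>

lemma chain_fun_upd [simp]:
  "i < k \<Longrightarrow> chain_prefix v (w(k := x)) i = chain_prefix v w i"
  "i < k \<Longrightarrow> chain_suffix \<alpha> (\<beta>(k := y)) i = chain_suffix \<alpha> \<beta> i"
  by (induction i) auto

text \<open>With \<open>A\<close> as \<open>C 0\<close>, all levels of a center-embedding have the same form.\<close>

definition chain ::
  "('n, 't) tree \<Rightarrow> nat \<Rightarrow> 't list \<Rightarrow> (nat \<Rightarrow> 't list) \<Rightarrow> (nat \<Rightarrow> node) \<Rightarrow> (nat \<Rightarrow> node) \<Rightarrow>
    (nat \<Rightarrow> (node, 't) symbol list) \<Rightarrow> (node, 't) symbol list \<Rightarrow> bool" where
  "chain T m v w B C \<beta> \<alpha> \<longleftrightarrow>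
     (node_step T)\<^sup>*\<^sup>* [NT []] (map Tm v @ NT (C 0) # \<alpha>) \<and>
     (\<forall>i < m.
        (node_step T)\<^sup>+\<^sup>+ (map Tm (chain_prefix v w i) @ NT (C i) # chain_suffix \<alpha> \<beta> i)
          (map Tm (chain_prefix v w (Suc i)) @ NT (B (Suc i)) # chain_suffix \<alpha> \<beta> i) \<and>
        (node_step T)\<^sup>+\<^sup>+ (map Tm (chain_prefix v w (Suc i)) @ NT (B (Suc i)) # chain_suffix \<alpha> \<beta> i)
          (map Tm (chain_prefix v w (Suc i)) @ NT (C (Suc i)) # chain_suffix \<alpha> \<beta> (Suc i)))"

lemma chain_reach:
  "chain T m v w B C \<beta> \<alpha> \<Longrightarrow> i \<le> m \<Longrightarrow> reach T i (chain_prefix v w i) (C i) (chain_suffix \<alpha> \<beta> i)"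
proof (induction i)
  case 0
  then show ?case by (auto simp: chain_def intro: reach.intros)
next
  case (Suc i)
  then show ?case
    using reach.reach_Suc[of T i "chain_prefix v w i" "C i" "chain_suffix \<alpha> \<beta> i" "w (Suc i)"
        "B (Suc i)" "C (Suc i)" "\<beta> (Suc i)"]
    by (simp add: chain_def)
qed

lemma reach_chain:
  "reach T m u D \<gamma> \<Longrightarrow> \<exists>v w B C \<beta> \<alpha>. chain T m v w B C \<beta> \<alpha> \<and>
     u = chain_prefix v w m \<and> D = C m \<and> \<gamma> = chain_suffix \<alpha> \<beta> m"
proof (induction rule: reach.induct)
  case (reach_0 v A \<alpha>)
  then have "chain T 0 v (\<lambda>_. []) (\<lambda>_. A) (\<lambda>_. A) (\<lambda>_. []) \<alpha>"
    by (simp add: chain_def)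
  then show ?case by fastforce
next
  case (reach_Suc m u D \<gamma> w' B' D' \<beta>')
  then obtain v w B C \<beta> \<alpha> where c: "chain T m v w B C \<beta> \<alpha>"
    "u = chain_prefix v w m" "D = C m" "\<gamma> = chain_suffix \<alpha> \<beta> m"
    by blast
  have "chain T (Suc m) v (w(Suc m := w')) (B(Suc m := B')) (C(Suc m := D')) (\<beta>(Suc m := \<beta>')) \<alpha>"
    using c reach_Suc.hyps(2,3) by (auto simp: chain_def less_Suc_eq simp del: map_append)
  moreover have "u @ w' = chain_prefix v (w(Suc m := w')) (Suc m)"
    "D' = (C(Suc m := D')) (Suc m)"
    "\<beta>' @ \<gamma> = chain_suffix \<alpha> (\<beta>(Suc m := \<beta>')) (Suc m)"
    using c(2,4) by simp_all
  ultimately show ?case by blast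
qed

lemma center_embedding_iff_chain:
  "center_embedding T m \<longleftrightarrow> m \<ge> 1 \<and> (\<exists>v w B C \<beta> \<alpha> x. chain T m v w B C \<beta> \<alpha> \<and> length x \<ge> 2 \<and>
     (node_step T)\<^sup>+\<^sup>+ (map Tm (chain_prefix v w m) @ NT (C m) # chain_suffix \<alpha> \<beta> m)
       (map Tm (chain_prefix v w m) @ map Tm x @ chain_suffix \<alpha> \<beta> m))"
  (is "_ \<longleftrightarrow> _ \<and> (\<exists>v w B C \<beta> \<alpha> x. ?chain v w B C \<beta> \<alpha> x)")
proof
  assume "center_embedding T m"
  then obtain v A \<alpha> w B C \<beta> x where m: "m \<ge> 1" and
    A: "(node_step T)\<^sup>*\<^sup>* [NT []] (map Tm v @ NT A # \<alpha>)"
      "(node_step T)\<^sup>+\<^sup>+ (map Tm v @ NT A # \<alpha>) (map Tm (chain_prefix v w 1) @ NT (B 1) # \<alpha>)" and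
    BC: "\<forall>i \<in> {1..m}. (node_step T)\<^sup>+\<^sup>+
      (map Tm (chain_prefix v w i) @ NT (B i) # chain_suffix \<alpha> \<beta> (i - 1))
      (map Tm (chain_prefix v w i) @ NT (C i) # chain_suffix \<alpha> \<beta> i)" and
    CB: "\<forall>i \<in> {1..<m}. (node_step T)\<^sup>+\<^sup>+
      (map Tm (chain_prefix v w i) @ NT (C i) # chain_suffix \<alpha> \<beta> i)
      (map Tm (chain_prefix v w (i + 1)) @ NT (B (i + 1)) # chain_suffix \<alpha> \<beta> i)" and
    x: "(node_step T)\<^sup>+\<^sup>+ (map Tm (chain_prefix v w m) @ NT (C m) # chain_suffix \<alpha> \<beta> m)
      (map Tm (chain_prefix v w m) @ map Tm x @ chain_suffix \<alpha> \<beta> m)" "length x \<ge> 2"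
    unfolding center_embedding_def Let_def chain_prefix_def[symmetric] chain_suffix_def[symmetric]
    by (auto simp: node_grammar_def simp del: chain_simps)
  \<comment> \<open>The nodes C of a center-embedding are indexed from 1, so index 0 is free for
    \<open>A\<close>, and \<open>m \<ge> 1\<close> keeps \<open>C m\<close> as it was.\<close>
  have "chain T m v w B (C(0 := A)) \<beta> \<alpha>"
    unfolding chain_def
  proof (intro conjI allI impI)
    fix i assume "i < m"
    then show "(node_step T)\<^sup>+\<^sup>+
        (map Tm (chain_prefix v w i) @ NT ((C(0 := A)) i) # chain_suffix \<alpha> \<beta> i)
        (map Tm (chain_prefix v w (Suc i)) @ NT (B (Suc i)) # chain_suffix \<alpha> \<beta> i)"
      using A(2) CB by (cases i) (auto simp del: chain_simps(2,4))
    show "(node_step T)\<^sup>+\<^sup>+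
        (map Tm (chain_prefix v w (Suc i)) @ NT (B (Suc i)) # chain_suffix \<alpha> \<beta> i)
        (map Tm (chain_prefix v w (Suc i)) @ NT ((C(0 := A)) (Suc i)) # chain_suffix \<alpha> \<beta> (Suc i))"
      using bspec[OF BC, of "Suc i"] \<open>i < m\<close> by (simp del: chain_simps)
  qed (use A(1) in simp)
  then have "?chain v w B (C(0 := A)) \<beta> \<alpha> x"
    using x m by simp
  then show "m \<ge> 1 \<and> (\<exists>v w B C \<beta> \<alpha> x. ?chain v w B C \<beta> \<alpha> x)"
    using m by blast
next
  assume "m \<ge> 1 \<and> (\<exists>v w B C \<beta> \<alpha> x. ?chain v w B C \<beta> \<alpha> x)"
  then obtain v w B C \<beta> \<alpha> x
    where m: "m \<ge> 1" and chain: "chain T m v w B C \<beta> \<alpha>" and "length x \<ge> 2"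
      "(node_step T)\<^sup>+\<^sup>+ (map Tm (chain_prefix v w m) @ NT (C m) # chain_suffix \<alpha> \<beta> m)
        (map Tm (chain_prefix v w m) @ map Tm x @ chain_suffix \<alpha> \<beta> m)"
    by blast
  moreover have "(node_step T)\<^sup>+\<^sup>+
      (map Tm (chain_prefix v w i) @ NT (B i) # chain_suffix \<alpha> \<beta> (i - 1))
      (map Tm (chain_prefix v w i) @ NT (C i) # chain_suffix \<alpha> \<beta> i)" if "i \<in> {1..m}" for i
    using chain that by (cases i) (auto simp: chain_def simp del: chain_simps)
  moreover have "(node_step T)\<^sup>+\<^sup>+
      (map Tm v @ NT (C 0) # \<alpha>) (map Tm (chain_prefix v w 1) @ NT (B 1) # \<alpha>)"
    using chain m unfolding chain_def by (metis One_nat_def Suc_le_eq chain_simps(1,3))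
  ultimately show "center_embedding T m"
    unfolding center_embedding_def Let_def chain_prefix_def[symmetric] chain_suffix_def[symmetric]
    by (intro conjI exI[of _ v] exI[of _ "C 0"] exI[of _ \<alpha>] exI[of _ w] exI[of _ B] exI[of _ C]
        exI[of _ \<beta>] exI[of _ x])
      (auto simp: node_grammar_def chain_def simp del: chain_simps)
qed


lemma center_embedding_iff_reach:
  "center_embedding T m \<longleftrightarrow> m \<ge> 1 \<and> (\<exists>v C \<alpha> x. reach T m v C \<alpha> \<and> length x \<ge> 2 \<and>
     (node_step T)\<^sup>+\<^sup>+ (map Tm v @ NT C # \<alpha>) (map Tm v @ map Tm x @ \<alpha>))"
proof
  assume "center_embedding T m"
  then show "m \<ge> 1 \<and> (\<exists>v C \<alpha> x. reach T m v C \<alpha> \<and> length x \<ge> 2 \<and>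
     (node_step T)\<^sup>+\<^sup>+ (map Tm v @ NT C # \<alpha>) (map Tm v @ map Tm x @ \<alpha>))"
    unfolding center_embedding_iff_chain using chain_reach[OF _ order_refl] by blast
next
  assume "m \<ge> 1 \<and> (\<exists>v C \<alpha> x. reach T m v C \<alpha> \<and> length x \<ge> 2 \<and>
     (node_step T)\<^sup>+\<^sup>+ (map Tm v @ NT C # \<alpha>) (map Tm v @ map Tm x @ \<alpha>))"
  then obtain u D \<gamma> x where *: "m \<ge> 1" "reach T m u D \<gamma>" "length x \<ge> 2"
     "(node_step T)\<^sup>+\<^sup>+ (map Tm u @ NT D # \<gamma>) (map Tm u @ map Tm x @ \<gamma>)"
    by blast
  obtain v w B C \<beta> \<alpha> where "chain T m v w B C \<beta> \<alpha>"
    "u = chain_prefix v w m" "D = C m" "\<gamma> = chain_suffix \<alpha> \<beta> m"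
    using reach_chain[OF *(2)] by blast
  then show "center_embedding T m"
    unfolding center_embedding_iff_chain using *(1,3,4) by blast
qed

text \<open>Strict because the last node spans two words: it is binary and retains an
  \<open>ldepth\<close> of at least 1.\<close>

lemma center_embedding_less_ldepth:
  assumes "parse_subtree G T" and "center_embedding T m"
  shows "m < ldepth T"
proof -
  obtain v C \<alpha> x where C: "reach T m v C \<alpha>" "length x \<ge> 2"
    "(node_step T)\<^sup>+\<^sup>+ (map Tm v @ NT C # \<alpha>) (map Tm v @ map Tm x @ \<alpha>)"
    using assms(2) by (auto simp: center_embedding_iff_reach)
  obtain s where s: "subtree T C = Some s" "m + ldepth s \<le> ldepth T"
    using reach_le_ldepth[OF C(1) assms(1)] by blast
  have "yield s = x"
    using sentence_node_steps[OF tranclp_into_rtranclp[OF C(3)]] s(1) by simp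
  then have "ldepth s > 0"
    using C(2) by (cases s) auto
  then show ?thesis using s(2) by simp
qed

lemma center_embedding_ldepth:
  assumes "parse_subtree G T" and "1 < ldepth T"
  shows "center_embedding T (ldepth T - 1)"
proof -
  have "reach T 0 [] [] []"
    by (intro reach.reach_0) simp
  then obtain v C \<alpha> A l r where
    C: "reach T (ldepth T - 1) v C \<alpha>" "subtree T C = Some (Bin A l r)"
    using reach_deeper(1)[OF assms(1), of T 0 "[]" "[]" "[]" "ldepth T - 1"] assms(2) by auto
  have s: "parse_subtree G (Bin A l r)"
    using subtree_parse assms(1) C(2) by blast
  then have "length (yield (Bin A l r)) \<ge> 2"
    using yield_parse_neq_Nil[of G l] yield_parse_neq_Nil[of G r]
    by (cases "yield l"; cases "yield r") auto
  moreover have "(node_step T)\<^sup>+\<^sup>+ (map Tm v @ NT C # \<alpha>)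
      (map Tm v @ map Tm (yield (Bin A l r)) @ \<alpha>)"
    unfolding lm_stepsp_prefix by (rule node_steps_yield[OF C(2) s])
  ultimately show ?thesis
    using C(1) assms(2) unfolding center_embedding_iff_reach by fastforce
qed

lemma degree_eq_ldepth:
  assumes "parse_subtree G T"
  shows "degree T = ldepth T - 1"
proof -
  have le: "m \<le> ldepth T - 1" if "center_embedding T m" for m
    using center_embedding_less_ldepth[OF assms that] by simp
  then have "finite {m. center_embedding T m}"
    by (auto simp: finite_nat_set_iff_bounded_le)
  \<comment> \<open>For \<open>ldepth T \<le> 1\<close> the truncated difference is 0, the default
    value in \<open>degree\<close>.\<close>
  moreover have "ldepth T - 1 \<in> insert 0 {m. center_embedding T m}"
    using center_embedding_ldepth[OF assms] by (cases "1 < ldepth T") auto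
  ultimately show ?thesis
    unfolding degree_def using le by (intro Max_eqI) auto
qed

theorem theorem2p1:
  fixes G :: "('n, 't) cfg" and T :: "('n, 't) tree"
  assumes "cfg G" and "cnf G" and "parse G T"
  shows "(\<exists>!\<rho>. recognizes G T \<rho>) \<and>
    (\<forall>\<rho>. recognizes G T \<rho> \<longrightarrow>
       (if reduce_depths \<rho> = {} then degree T = 0
        else int (degree T) = int (Max (reduce_depths \<rho>)) - 1))"
proof -
  have degree: "degree T = ldepth T - 1"
    using assms(3) degree_eq_ldepth by (auto simp: parse_def)
  have "if reduce_depths \<rho> = {} then degree T = 0
      else int (degree T) = int (Max (reduce_depths \<rho>)) - 1" if "recognizes G T \<rho>" for \<rho>
  proof (cases "reduce_depths \<rho> = {}")
    case True
    \<comment> \<open>A positive \<open>ldepth T\<close> would be attained by some reduce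
      transition.\<close>
    then have "ldepth T = 0"
      using recognizes_unique[OF that recognizes_lmoves[OF assms(3)]]
        depth_in_reduce_depths_moves(1)[of T "[]" 0] by auto
    then show ?thesis using True degree by simp
  next
    case False
    \<comment> \<open>Here \<open>ldepth T\<close> is positive, so the difference on naturals agrees
      with that on integers.\<close>
    then show ?thesis
      using recognizes_unique[OF that recognizes_lmoves[OF assms(3)]]
        Max_reduce_depths_lmoves[of T] degree by simp
  qed
  then show ?thesis
    using recognizes_lmoves[OF assms(3)] recognizes_unique by blast
qed

end
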